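(* Let $g(n)$ denote the number of maximal independent sets of the para-hexagonal cactus $G(n)$. Then $g(1)=5$, $g(2)=19$, $g(3)=76$, and $g(n)=5g(n-1)-4g(n-2)+g(n-3)$ for all $n\ge 4$.
   Context: For $n\ge 1$, the para-hexagonal cactus $G(n)$ is the graph formed by a chain of $n$ 6-cycles $B_1,\dots,B_n$, where for each $1\le i\le n-1$ the consecutive cycles $B_i$ and $B_{i+1}$ share exactly one vertex, non-consecutive cycles share no vertex, every vertex lies in at most two cycles, and for each $2\le i\le n-1$ the two shared (cut) vertices of $B_i$ are at distance three in $B_i$ (antipodal vertices of the hexagon). An independent set is maximal if no further vertex can be added while keeping it independent. *)

theory Defs
  imports Main
begin

text \<open>A simple graph is given by its vertex set and its set of two-element edges.\<close>

type_synonym 'a sgraph = "'a set \<times> 'a set set"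

abbreviation vertices :: "'a sgraph \<Rightarrow> 'a set" where
  "vertices \<equiv> fst"

abbreviation edges :: "'a sgraph \<Rightarrow> 'a set set" where
  "edges \<equiv> snd"

definition adjacent :: "'a sgraph \<Rightarrow> 'a \<Rightarrow> 'a \<Rightarrow> bool" where
  "adjacent G u v \<longleftrightarrow> {u, v} \<in> edges G"

definition graph_dist :: "'a sgraph \<Rightarrow> 'a \<Rightarrow> 'a \<Rightarrow> nat" where
  "graph_dist G u v = (LEAST k. (adjacent G ^^ k) u v)"

definition cycle_graph :: "'a list \<Rightarrow> 'a sgraph" where
  "cycle_graph xs =
     (set xs, {{xs ! i, xs ! (Suc i mod length xs)} | i. i < length xs})"

definition is_cycle :: "nat \<Rightarrow> 'a sgraph \<Rightarrow> bool" where
  "is_cycle k C \<longleftrightarrow> k \<ge> 3 \<and> (\<exists>xs. length xs = k \<and> distinct xs \<and> C = cycle_graph xs)"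

definition para_hexagonal_cactus :: "nat \<Rightarrow> 'a sgraph \<Rightarrow> bool" where
  "para_hexagonal_cactus n G \<longleftrightarrow> n \<ge> 1 \<and> (\<exists>B :: nat \<Rightarrow> 'a sgraph.
     (\<forall>i\<in>{1..n}. is_cycle 6 (B i)) \<and>
     (\<forall>i\<in>{1..n-1}. card (vertices (B i) \<inter> vertices (B (i+1))) = 1) \<and>
     (\<forall>i\<in>{1..n}. \<forall>j\<in>{1..n}. i + 1 < j \<longrightarrow> vertices (B i) \<inter> vertices (B j) = {}) \<and>
     (\<forall>v. card {i \<in> {1..n}. v \<in> vertices (B i)} \<le> 2) \<and>
     (\<forall>i\<in>{2..n-1}. \<forall>u \<in> vertices (B (i-1)) \<inter> vertices (B i).
        \<forall>w \<in> vertices (B i) \<inter> vertices (B (i+1)). graph_dist (B i) u w = 3) \<and>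
     G = (\<Union>i\<in>{1..n}. vertices (B i), \<Union>i\<in>{1..n}. edges (B i)))"

definition independent_set :: "'a sgraph \<Rightarrow> 'a set \<Rightarrow> bool" where
  "independent_set G S \<longleftrightarrow> S \<subseteq> vertices G \<and> (\<forall>u\<in>S. \<forall>v\<in>S. \<not> adjacent G u v)"

definition maximal_independent_set :: "'a sgraph \<Rightarrow> 'a set \<Rightarrow> bool" where
  "maximal_independent_set G S \<longleftrightarrow> independent_set G S \<and>
     (\<forall>v \<in> vertices G - S. \<not> independent_set G (insert v S))"

definition num_maximal_independent_sets :: "'a sgraph \<Rightarrow> nat" where
  "num_maximal_independent_sets G = card {S. maximal_independent_set G S}"

text \<open>Such a graph exists for every \<open>n \<ge> 1\<close>: hexagon \<open>i\<close> below has cut vertices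
  \<open>5 * i\<close> and \<open>5 * i + 5\<close>.\<close>

definition hexagon :: "nat \<Rightarrow> nat list" where
  "hexagon i = [5*i, 5*i+1, 5*i+2, 5*i+5, 5*i+3, 5*i+4]"

lemma hexagon_vertices: "vertices (cycle_graph (hexagon i)) = {5*i..5*i+5}"
  by (auto simp: cycle_graph_def hexagon_def)

lemma hexagon_edges:
  "edges (cycle_graph (hexagon i)) =
     {{5*i,5*i+1}, {5*i+1,5*i+2}, {5*i+2,5*i+5}, {5*i+5,5*i+3}, {5*i+3,5*i+4}, {5*i+4,5*i}}"
proof -
  have *: "{f j | j. j < 6} = f ` {0,1,2,3,4,5}" for f :: "nat \<Rightarrow> nat set"
  proof -
    have "{..<6} = {0,1,2,3,4,5::nat}" by auto
    moreover have "{f j | j. j < 6} = f ` {..<6}" by auto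
    ultimately show ?thesis by simp
  qed
  have "length (hexagon i) = 6" by (simp add: hexagon_def)
  then have "edges (cycle_graph (hexagon i)) =
      (\<lambda>j. {hexagon i ! j, hexagon i ! (Suc j mod 6)}) ` {0,1,2,3,4,5}"
    unfolding cycle_graph_def snd_conv by (simp only: *)
  then show ?thesis by (simp add: hexagon_def)
qed

lemma hexagon_dist: "graph_dist (cycle_graph (hexagon i)) (5*i) (5*i+5) = 3"
  unfolding graph_dist_def
proof (rule Least_equality)
  let ?A = "adjacent (cycle_graph (hexagon i))"
  have "?A (5*i) (5*i+1)" "?A (5*i+1) (5*i+2)" "?A (5*i+2) (5*i+5)"
    unfolding adjacent_def hexagon_edges by simp_all
  then show "(?A ^^ 3) (5*i) (5*i+5)"
    by (auto simp: numeral_3_eq_3)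
next
  let ?A = "adjacent (cycle_graph (hexagon i))"
  have start: "v = 5*i+1 \<or> v = 5*i+4" if "?A (5*i) v" for v
    using that unfolding adjacent_def hexagon_edges insert_iff empty_iff doubleton_eq_iff
    by (elim disjE conjE) simp_all
  have finish: "v = 5*i+2 \<or> v = 5*i+3" if "?A v (5*i+5)" for v
    using that unfolding adjacent_def hexagon_edges insert_iff empty_iff doubleton_eq_iff
    by (elim disjE conjE) simp_all
  fix k assume k: "(?A ^^ k) (5*i) (5*i+5)"
  show "3 \<le> k"
  proof (rule ccontr)
    assume "\<not> 3 \<le> k"
    then consider "k = 0" | "k = 1" | "k = 2" by linarith
    then show False
    proof cases
      case 1
      with k show False by simp
    next
      case 2
      with k have "?A (5*i) (5*i+5)" by auto
      from start[OF this] show False by simp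
    next
      case 3
      with k obtain v where "?A (5*i) v" "?A v (5*i+5)"
        by (auto simp: numeral_2_eq_2)
      from start[OF this(1)] finish[OF this(2)] show False by auto
    qed
  qed
qed

lemma para_hexagonal_cactus_exists:
  assumes "n \<ge> 1"
  shows "\<exists>G :: nat sgraph. para_hexagonal_cactus n G"
proof -
  let ?B = "\<lambda>i. cycle_graph (hexagon i)"
  have cyc: "is_cycle 6 (?B i)" for i
    unfolding is_cycle_def by (intro conjI exI[of _ "hexagon i"]) (auto simp: hexagon_def)
  have cut: "{5*i..5*i+5} \<inter> {5*(i+1)..5*(i+1)+5} = {5*i+5}" for i :: nat
    by auto
  have prev: "{5*(i-1)..5*(i-1)+5} \<inter> {5*i..5*i+5} = {5*i}" if "i \<ge> 2" for i :: nat
    using that by auto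
  have two: "card {i \<in> {1..n}. v \<in> {5*i..5*i+5}} \<le> 2" for v :: nat
  proof -
    have "i = v div 5 \<or> i = v div 5 - 1" if "5*i \<le> v" "v \<le> 5*i+5" for i
      using that by linarith
    then have "{i \<in> {1..n}. v \<in> {5*i..5*i+5}} \<subseteq> {v div 5, v div 5 - 1}"
      by (simp add: subset_iff)
    then have "card {i \<in> {1..n}. v \<in> {5*i..5*i+5}} \<le> card {v div 5, v div 5 - 1}"
      by (rule card_mono[rotated]) simp
    also have "\<dots> \<le> 2"
      by (simp add: card_insert_if)
    finally show ?thesis .
  qed
  have "para_hexagonal_cactus n (\<Union>i\<in>{1..n}. vertices (?B i), \<Union>i\<in>{1..n}. edges (?B i))"
    unfolding para_hexagonal_cactus_def
  proof (intro conjI exI[of _ ?B])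
    show "\<forall>i\<in>{2..n-1}. \<forall>u \<in> vertices (?B (i-1)) \<inter> vertices (?B i).
        \<forall>w \<in> vertices (?B i) \<inter> vertices (?B (i+1)). graph_dist (?B i) u w = 3"
    proof (intro ballI)
      fix i u w
      assume "i \<in> {2..n-1}" and u: "u \<in> vertices (?B (i-1)) \<inter> vertices (?B i)"
        and w: "w \<in> vertices (?B i) \<inter> vertices (?B (i+1))"
      then have "i \<ge> 2" by simp
      have "u = 5*i"
        using u unfolding hexagon_vertices prev[OF \<open>i \<ge> 2\<close>] by (rule singletonD)
      moreover have "w = 5*i+5"
        using w unfolding hexagon_vertices cut by (rule singletonD)
      ultimately show "graph_dist (?B i) u w = 3"
        by (simp only: hexagon_dist)
    qed
    show "\<forall>i\<in>{1..n-1}. card (vertices (?B i) \<inter> vertices (?B (i+1))) = 1"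
      unfolding hexagon_vertices cut by simp
    show "\<forall>v. card {i \<in> {1..n}. v \<in> vertices (?B i)} \<le> 2"
      unfolding hexagon_vertices using two by blast
    show "\<forall>i\<in>{1..n}. \<forall>j\<in>{1..n}. i + 1 < j \<longrightarrow> vertices (?B i) \<inter> vertices (?B j) = {}"
      unfolding hexagon_vertices by auto
  qed (use assms cyc in simp_all)
  then show ?thesis by blast
qed

end

theory Submission
  imports Defs
begin

text \<open>Transfer-matrix argument. Build the cactus one hexagon at a time and follow its last vertex
  \<open>w\<close>, antipodal to the previous cut vertex. Among the independent sets dominating every vertex
  except possibly \<open>w\<close>, let \<open>a\<close> count those containing \<open>w\<close>, \<open>b\<close> those that only dominate \<open>w\<close>, and
  \<open>c\<close> those that leave \<open>w\<close> undominated. Attaching a hexagon replaces \<open>(a, b, c)\<close> by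
  \<open>(a + b + c, a + 3 * b + 2 * c, b + c)\<close>; the number of maximal independent sets is \<open>a + b\<close>, and the
  recurrence is Cayley--Hamilton for the characteristic polynomial
  \<open>x^3 - 5 * x^2 + 4 * x - 1\<close> of this linear map.\<close>

definition attach_hexagon :: "'a sgraph \<Rightarrow> 'a \<Rightarrow> 'a \<Rightarrow> 'a \<Rightarrow> 'a \<Rightarrow> 'a \<Rightarrow> 'a \<Rightarrow> 'a sgraph" where
  "attach_hexagon G w p q z r s =
     (vertices G \<union> {p, q, z, r, s},
      edges G \<union> {{w, p}, {p, q}, {q, z}, {z, r}, {r, s}, {s, w}})"

inductive hexagon_chain :: "nat \<Rightarrow> 'a sgraph \<Rightarrow> 'a \<Rightarrow> bool" where
  vertex: "hexagon_chain 0 ({w}, {}) w"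
| attach: "hexagon_chain n G w \<Longrightarrow> distinct [p, q, z, r, s] \<Longrightarrow>
    vertices G \<inter> {p, q, z, r, s} = {} \<Longrightarrow>
    hexagon_chain (Suc n) (attach_hexagon G w p q z r s) z"

definition dominates :: "'a sgraph \<Rightarrow> 'a set \<Rightarrow> 'a \<Rightarrow> bool" where
  "dominates G S v \<longleftrightarrow> (\<exists>u\<in>S. adjacent G u v)"

definition maximal_off :: "'a sgraph \<Rightarrow> 'a \<Rightarrow> 'a set \<Rightarrow> bool" where
  "maximal_off G w S \<longleftrightarrow> independent_set G S \<and> (\<forall>v \<in> vertices G - S - {w}. dominates G S v)"

definition selecting :: "'a sgraph \<Rightarrow> 'a \<Rightarrow> 'a set set" where
  "selecting G w = {S. maximal_off G w S \<and> w \<in> S}"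

definition dominating :: "'a sgraph \<Rightarrow> 'a \<Rightarrow> 'a set set" where
  "dominating G w = {S. maximal_off G w S \<and> w \<notin> S \<and> dominates G S w}"

definition missing :: "'a sgraph \<Rightarrow> 'a \<Rightarrow> 'a set set" where
  "missing G w = {S. maximal_off G w S \<and> w \<notin> S \<and> \<not> dominates G S w}"

lemmas state_defs = selecting_def dominating_def missing_def

lemma adjacent_commute: "adjacent G u v \<longleftrightarrow> adjacent G v u"
  by (simp add: adjacent_def insert_commute)

lemma hexagon_chain_wf:
  assumes "hexagon_chain n G w"
  shows "finite (vertices G)" "w \<in> vertices G" "\<forall>e \<in> edges G. e \<subseteq> vertices G \<and> card e = 2"
  using assms by (induction rule: hexagon_chain.induct) (auto simp: attach_hexagon_def card_2_iff')

lemma states_subset_Pow: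
  "selecting G w \<subseteq> Pow (vertices G)" "dominating G w \<subseteq> Pow (vertices G)"
  "missing G w \<subseteq> Pow (vertices G)"
  by (auto simp: state_defs maximal_off_def independent_set_def)

locale hexagon_attachment =
  fixes G :: "'a sgraph" and w p q z r s :: 'a
  assumes finite_vertices: "finite (vertices G)"
    and w_vertex: "w \<in> vertices G"
    and edges_wf: "\<forall>e \<in> edges G. e \<subseteq> vertices G \<and> card e = 2"
    and new_distinct: "distinct [p, q, z, r, s]"
    and new_fresh: "vertices G \<inter> {p, q, z, r, s} = {}"
begin

abbreviation new :: "'a set" where "new \<equiv> {p, q, z, r, s}"

abbreviation G' :: "'a sgraph" where "G' \<equiv> attach_hexagon G w p q z r s"

lemma adjacent_old: "u \<in> vertices G \<Longrightarrow> v \<in> vertices G \<Longrightarrow> adjacent G' u v \<longleftrightarrow> adjacent G u v"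
  using new_fresh by (auto simp: adjacent_def attach_hexagon_def doubleton_eq_iff)

lemma adjacent_new:
  "adjacent G' u p \<longleftrightarrow> u = w \<or> u = q"
  "adjacent G' u q \<longleftrightarrow> u = p \<or> u = z"
  "adjacent G' u z \<longleftrightarrow> u = q \<or> u = r"
  "adjacent G' u r \<longleftrightarrow> u = z \<or> u = s"
  "adjacent G' u s \<longleftrightarrow> u = r \<or> u = w"
proof -
  have "\<not> adjacent G u v" if "v \<in> new" for v
    using that edges_wf new_fresh by (auto simp: adjacent_def)
  then have *: "adjacent G' u v \<longleftrightarrow> {u, v} \<in> {{w, p}, {p, q}, {q, z}, {z, r}, {r, s}, {s, w}}"
    if "v \<in> new" for v
    using that by (simp add: adjacent_def attach_hexagon_def)
  show "adjacent G' u p \<longleftrightarrow> u = w \<or> u = q"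
    "adjacent G' u q \<longleftrightarrow> u = p \<or> u = z"
    "adjacent G' u z \<longleftrightarrow> u = q \<or> u = r"
    "adjacent G' u r \<longleftrightarrow> u = z \<or> u = s"
    "adjacent G' u s \<longleftrightarrow> u = r \<or> u = w"
    using new_distinct new_fresh w_vertex by (auto simp: * doubleton_eq_iff)
qed

lemma adjacent_new':
  "adjacent G' p u \<longleftrightarrow> u = w \<or> u = q"
  "adjacent G' q u \<longleftrightarrow> u = p \<or> u = z"
  "adjacent G' z u \<longleftrightarrow> u = q \<or> u = r"
  "adjacent G' r u \<longleftrightarrow> u = z \<or> u = s"
  "adjacent G' s u \<longleftrightarrow> u = r \<or> u = w"
  using adjacent_new by (simp_all add: adjacent_commute[of _ _ u])

context
  fixes S T :: "'a set"
  assumes S: "S \<subseteq> vertices G" and T: "T \<subseteq> new"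
begin

lemma mem_union:
  "v \<in> vertices G \<Longrightarrow> v \<in> S \<union> T \<longleftrightarrow> v \<in> S"
  "v \<in> new \<Longrightarrow> v \<in> S \<union> T \<longleftrightarrow> v \<in> T"
  using S T new_fresh by blast+

lemma dominates_old:
  assumes v: "v \<in> vertices G"
  shows "dominates G' (S \<union> T) v \<longleftrightarrow> dominates G S v \<or> v = w \<and> (p \<in> T \<or> s \<in> T)"
proof -
  have "(\<exists>u\<in>S. adjacent G' u v) \<longleftrightarrow> dominates G S v"
    using S v adjacent_old by (auto simp: dominates_def)
  moreover have "(\<exists>u\<in>T. adjacent G' u v) \<longleftrightarrow> v = w \<and> (p \<in> T \<or> s \<in> T)"
  proof -
    have "(\<exists>u\<in>T. adjacent G' u v) \<longleftrightarrow> (\<exists>u\<in>new. u \<in> T \<and> adjacent G' u v)"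
      using T by blast
    moreover have "v \<notin> new"
      using v new_fresh by blast
    ultimately show ?thesis
      by (auto simp: adjacent_new')
  qed
  ultimately show ?thesis
    by (auto simp: dominates_def)
qed

lemma dominates_new:
  "dominates G' (S \<union> T) p \<longleftrightarrow> w \<in> S \<or> q \<in> T"
  "dominates G' (S \<union> T) q \<longleftrightarrow> p \<in> T \<or> z \<in> T"
  "dominates G' (S \<union> T) z \<longleftrightarrow> q \<in> T \<or> r \<in> T"
  "dominates G' (S \<union> T) r \<longleftrightarrow> z \<in> T \<or> s \<in> T"
  "dominates G' (S \<union> T) s \<longleftrightarrow> r \<in> T \<or> w \<in> S"
  using mem_union w_vertex by (auto simp: dominates_def adjacent_new)

lemma independent_union:
  "independent_set G' (S \<union> T) \<longleftrightarrow> independent_set G S \<and>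
     \<not> (w \<in> S \<and> p \<in> T) \<and> \<not> (p \<in> T \<and> q \<in> T) \<and> \<not> (q \<in> T \<and> z \<in> T) \<and>
     \<not> (z \<in> T \<and> r \<in> T) \<and> \<not> (r \<in> T \<and> s \<in> T) \<and> \<not> (s \<in> T \<and> w \<in> S)"
proof -
  have "independent_set G' (S \<union> T) \<longleftrightarrow>
      (\<forall>v\<in>S. \<not> dominates G' (S \<union> T) v) \<and> (\<forall>v\<in>T. \<not> dominates G' (S \<union> T) v)"
    using S T by (auto simp: independent_set_def dominates_def attach_hexagon_def)
  also have "(\<forall>v\<in>S. \<not> dominates G' (S \<union> T) v) \<longleftrightarrow>
      independent_set G S \<and> \<not> (w \<in> S \<and> p \<in> T) \<and> \<not> (s \<in> T \<and> w \<in> S)"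
    using S dominates_old by (auto simp: independent_set_def dominates_def)
  also have "(\<forall>v\<in>T. \<not> dominates G' (S \<union> T) v) \<longleftrightarrow> (\<forall>v\<in>new. v \<in> T \<longrightarrow> \<not> dominates G' (S \<union> T) v)"
    using T by blast
  finally show ?thesis
    by (simp add: dominates_new) blast
qed

lemma maximal_off_union:
  "maximal_off G' z (S \<union> T) \<longleftrightarrow> maximal_off G w S \<and> independent_set G' (S \<union> T) \<and>
     (w \<in> S \<or> dominates G S w \<or> p \<in> T \<or> s \<in> T) \<and>
     (p \<in> T \<or> w \<in> S \<or> q \<in> T) \<and> (q \<in> T \<or> p \<in> T \<or> z \<in> T) \<and>
     (r \<in> T \<or> z \<in> T \<or> s \<in> T) \<and> (s \<in> T \<or> r \<in> T \<or> w \<in> S)"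
proof -
  have "(\<forall>v \<in> vertices G' - (S \<union> T) - {z}. dominates G' (S \<union> T) v) \<longleftrightarrow>
      (\<forall>v \<in> vertices G. v \<in> S \<or> dominates G' (S \<union> T) v) \<and>
      (\<forall>v \<in> {p, q, r, s}. v \<in> T \<or> dominates G' (S \<union> T) v)"
    using S T new_fresh new_distinct unfolding attach_hexagon_def fst_conv by auto
  also have "(\<forall>v \<in> vertices G. v \<in> S \<or> dominates G' (S \<union> T) v) \<longleftrightarrow>
      (\<forall>v \<in> vertices G - S - {w}. dominates G S v) \<and>
      (w \<in> S \<or> dominates G S w \<or> p \<in> T \<or> s \<in> T)"
    using dominates_old w_vertex by auto
  finally show ?thesis
    unfolding maximal_off_def by (simp add: dominates_new independent_union) blast
qed

lemma new_subset_eq_iff: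
  assumes "U \<subseteq> new"
  shows "T = U \<longleftrightarrow> (p \<in> T \<longleftrightarrow> p \<in> U) \<and> (q \<in> T \<longleftrightarrow> q \<in> U) \<and> (z \<in> T \<longleftrightarrow> z \<in> U) \<and>
    (r \<in> T \<longleftrightarrow> r \<in> U) \<and> (s \<in> T \<longleftrightarrow> s \<in> U)"
  using assms T by blast

lemma T_eq_iff:
  "T = {z} \<longleftrightarrow> p \<notin> T \<and> q \<notin> T \<and> z \<in> T \<and> r \<notin> T \<and> s \<notin> T"
  "T = {p, z, s} \<longleftrightarrow> p \<in> T \<and> q \<notin> T \<and> z \<in> T \<and> r \<notin> T \<and> s \<in> T"
  "T = {q, r} \<longleftrightarrow> p \<notin> T \<and> q \<in> T \<and> z \<notin> T \<and> r \<in> T \<and> s \<notin> T"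
  "T = {p, r} \<longleftrightarrow> p \<in> T \<and> q \<notin> T \<and> z \<notin> T \<and> r \<in> T \<and> s \<notin> T"
  "T = {q, s} \<longleftrightarrow> p \<notin> T \<and> q \<in> T \<and> z \<notin> T \<and> r \<notin> T \<and> s \<in> T"
  "T = {p, s} \<longleftrightarrow> p \<in> T \<and> q \<notin> T \<and> z \<notin> T \<and> r \<notin> T \<and> s \<in> T"
  using new_distinct by (subst new_subset_eq_iff; auto)+

lemma selecting_union:
  "S \<union> T \<in> selecting G' z \<longleftrightarrow>
     S \<in> selecting G w \<and> T = {z} \<or> S \<in> dominating G w \<union> missing G w \<and> T = {p, z, s}"
proof -
  have "z \<in> S \<union> T \<longleftrightarrow> z \<in> T" by (rule mem_union) simp
  moreover have "maximal_off G w S \<Longrightarrow> independent_set G S" by (simp add: maximal_off_def)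
  ultimately show ?thesis
    unfolding state_defs mem_Collect_eq T_eq_iff maximal_off_union independent_union Un_iff by blast
qed

lemma dominating_union:
  "S \<union> T \<in> dominating G' z \<longleftrightarrow>
     S \<in> selecting G w \<and> T = {q, r} \<or> S \<in> dominating G w \<and> T \<in> {{q, r}, {p, r}, {q, s}} \<or>
     S \<in> missing G w \<and> T \<in> {{p, r}, {q, s}}"
proof -
  have "z \<in> S \<union> T \<longleftrightarrow> z \<in> T" by (rule mem_union) simp
  moreover have "maximal_off G w S \<Longrightarrow> independent_set G S" by (simp add: maximal_off_def)
  ultimately show ?thesis
    unfolding state_defs mem_Collect_eq insert_iff empty_iff T_eq_iff maximal_off_union
      independent_union dominates_new
    by (cases "z \<in> T"; cases "p \<in> T"; cases "q \<in> T"; cases "r \<in> T"; cases "s \<in> T"; simp; blast)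
qed

lemma missing_union:
  "S \<union> T \<in> missing G' z \<longleftrightarrow> S \<in> dominating G w \<union> missing G w \<and> T = {p, s}"
proof -
  have "z \<in> S \<union> T \<longleftrightarrow> z \<in> T" by (rule mem_union) simp
  moreover have "maximal_off G w S \<Longrightarrow> independent_set G S" by (simp add: maximal_off_def)
  ultimately show ?thesis
    unfolding state_defs mem_Collect_eq T_eq_iff maximal_off_union independent_union
      dominates_new Un_iff by blast
qed

end

lemma card_union_image:
  assumes X: "X \<subseteq> Pow (vertices G')"
    and Y: "Y \<subseteq> Pow (vertices G) \<times> Pow new"
    and iff: "\<And>S T. S \<subseteq> vertices G \<Longrightarrow> T \<subseteq> new \<Longrightarrow> S \<union> T \<in> X \<longleftrightarrow> (S, T) \<in> Y"
  shows "card X = card Y"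
proof -
  have "bij_betw (\<lambda>(S, T). S \<union> T) Y X"
  proof (rule bij_betw_byWitness[where f' = "\<lambda>U. (U \<inter> vertices G, U \<inter> new)"])
    have eq: "(U \<inter> vertices G) \<union> (U \<inter> new) = U" if "U \<in> X" for U
      using X that by (auto simp: attach_hexagon_def)
    then show "\<forall>U\<in>X. (\<lambda>(S, T). S \<union> T) (U \<inter> vertices G, U \<inter> new) = U"
      by simp
    have "(U \<inter> vertices G, U \<inter> new) \<in> Y" if "U \<in> X" for U
      using that eq[OF that] iff[of "U \<inter> vertices G" "U \<inter> new"] by simp
    then show "(\<lambda>U. (U \<inter> vertices G, U \<inter> new)) ` X \<subseteq> Y"
      by blast
    have "(S \<union> T) \<inter> vertices G = S" "(S \<union> T) \<inter> new = T" if "(S, T) \<in> Y" for S T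
      using Y that new_fresh by blast+
    then show "\<forall>x\<in>Y. ((\<lambda>(S, T). S \<union> T) x \<inter> vertices G, (\<lambda>(S, T). S \<union> T) x \<inter> new) = x"
      by (simp add: split_beta del: Int_insert_right)
    show "(\<lambda>(S, T). S \<union> T) ` Y \<subseteq> X"
      using Y iff by auto
  qed
  then show ?thesis
    by (simp add: bij_betw_same_card)
qed

lemma finite_states: "finite (selecting G w)" "finite (dominating G w)" "finite (missing G w)"
  using states_subset_Pow finite_vertices by (meson finite_Pow_iff finite_subset)+

lemma states_disjoint:
  "selecting G w \<inter> dominating G w = {}" "selecting G w \<inter> missing G w = {}"
  "dominating G w \<inter> missing G w = {}"
  by (auto simp: state_defs)

lemma card_states_product:
  assumes "finite A" "finite B" "finite C"
  shows "card (selecting G w \<times> A \<union> (dominating G w \<times> B \<union> missing G w \<times> C)) =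
    card (selecting G w) * card A + card (dominating G w) * card B + card (missing G w) * card C"
proof -
  have "(selecting G w \<times> A) \<inter> (dominating G w \<times> B \<union> missing G w \<times> C) = {}"
    "(dominating G w \<times> B) \<inter> (missing G w \<times> C) = {}"
    using states_disjoint by blast+
  then show ?thesis
    using assms by (simp add: card_Un_disjoint finite_states card_cartesian_product)
qed

lemma card_selecting:
  "card (selecting G' z) = card (selecting G w) + card (dominating G w) + card (missing G w)"
proof -
  let ?Y = "selecting G w \<times> {{z}} \<union> (dominating G w \<times> {{p, z, s}} \<union> missing G w \<times> {{p, z, s}})"
  have "card (selecting G' z) = card ?Y"
  proof (rule card_union_image[OF states_subset_Pow(1)])
    show "?Y \<subseteq> Pow (vertices G) \<times> Pow new"
      using states_subset_Pow[of G w] by blast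
  qed (subst selecting_union; blast)
  also have "\<dots> = card (selecting G w) + card (dominating G w) + card (missing G w)"
    by (simp add: card_states_product)
  finally show ?thesis .
qed

lemma card_dominating:
  "card (dominating G' z) =
     card (selecting G w) + 3 * card (dominating G w) + 2 * card (missing G w)"
proof -
  let ?Y = "selecting G w \<times> {{q, r}} \<union> (dominating G w \<times> {{q, r}, {p, r}, {q, s}} \<union>
    missing G w \<times> {{p, r}, {q, s}})"
  have "card (dominating G' z) = card ?Y"
  proof (rule card_union_image[OF states_subset_Pow(2)])
    show "?Y \<subseteq> Pow (vertices G) \<times> Pow new"
      using states_subset_Pow[of G w] by blast
  qed (simp add: dominating_union)
  also have "\<dots> = card (selecting G w) + 3 * card (dominating G w) + 2 * card (missing G w)"
    using new_distinct by (auto simp: card_states_product card_insert_if doubleton_eq_iff)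
  finally show ?thesis .
qed

lemma card_missing: "card (missing G' z) = card (dominating G w) + card (missing G w)"
proof -
  let ?Y = "(dominating G w \<union> missing G w) \<times> {{p, s}}"
  have "card (missing G' z) = card ?Y"
  proof (rule card_union_image[OF states_subset_Pow(3)])
    show "?Y \<subseteq> Pow (vertices G) \<times> Pow new"
      using states_subset_Pow[of G w] by blast
  qed (subst missing_union; blast)
  also have "\<dots> = card (dominating G w) + card (missing G w)"
    by (simp add: card_cartesian_product card_Un_disjoint finite_states states_disjoint)
  finally show ?thesis .
qed

end

fun state_counts :: "nat \<Rightarrow> nat \<times> nat \<times> nat" where
  "state_counts 0 = (1, 0, 1)"
| "state_counts (Suc n) = (case state_counts n of (a, b, c) \<Rightarrow> (a + b + c, a + 3 * b + 2 * c, b + c))"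

lemma state_counts_chain:
  assumes "hexagon_chain n G w"
  shows "state_counts n = (card (selecting G w), card (dominating G w), card (missing G w))"
  using assms
proof (induction rule: hexagon_chain.induct)
  case (vertex w)
  have "selecting ({w}, {}) w = {{w}}" "dominating ({w}, {}) w = {}" "missing ({w}, {}) w = {{}}"
    by (auto simp: state_defs maximal_off_def independent_set_def adjacent_def dominates_def)
  then show ?case by simp
next
  case (attach n G w p q z r s)
  interpret hexagon_attachment G w p q z r s
    using hexagon_chain_wf[OF attach.hyps(1)] attach.hyps by unfold_locales auto
  show ?case
    by (simp add: attach.IH card_selecting card_dominating card_missing)
qed

lemma maximal_independent_set_iff:
  assumes "\<forall>v. \<not> adjacent G v v" "w \<in> vertices G"
  shows "maximal_independent_set G S \<longleftrightarrow> maximal_off G w S \<and> (w \<in> S \<or> dominates G S w)"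
proof -
  have "\<not> independent_set G (insert v S) \<longleftrightarrow> dominates G S v"
    if "independent_set G S" "v \<in> vertices G" for v
    using that assms(1) adjacent_commute[of G v]
    by (auto simp: independent_set_def dominates_def)
  then show ?thesis
    using assms(2) by (auto simp: maximal_independent_set_def maximal_off_def)
qed

lemma num_maximal_independent_sets_chain:
  assumes "hexagon_chain n G w"
  shows "num_maximal_independent_sets G = (case state_counts n of (a, b, c) \<Rightarrow> a + b)"
proof -
  note wf = hexagon_chain_wf[OF assms]
  have "\<forall>v. \<not> adjacent G v v"
    using wf(3) by (force simp: adjacent_def)
  then have "{S. maximal_independent_set G S} = selecting G w \<union> dominating G w"
    using wf(2) by (auto simp: state_defs maximal_independent_set_iff)
  moreover have "finite (selecting G w)" "finite (dominating G w)"
    using states_subset_Pow wf(1) by (meson finite_Pow_iff finite_subset)+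
  moreover have "selecting G w \<inter> dominating G w = {}"
    by (auto simp: state_defs)
  ultimately show ?thesis
    by (simp add: num_maximal_independent_sets_def card_Un_disjoint state_counts_chain[OF assms])
qed

lemma cycle_graph_6:
  "cycle_graph [a, b, c, d, e, f] =
     ({a, b, c, d, e, f}, {{a, b}, {b, c}, {c, d}, {d, e}, {e, f}, {f, a}})"
proof -
  have "{h j | j. j < 6} = {h 0, h 1, h 2, h 3, h 4, h 5}" for h :: "nat \<Rightarrow> 'a set"
  proof -
    have "{..<6} = {0, 1, 2, 3, 4, 5::nat}" by auto
    moreover have "{h j | j. j < 6} = h ` {..<6}" by auto
    ultimately show ?thesis by simp
  qed
  note this[of "\<lambda>i. {[a, b, c, d, e, f] ! i, [a, b, c, d, e, f] ! (Suc i mod 6)}"]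
  moreover have "length [a, b, c, d, e, f] = 6" by simp
  ultimately show ?thesis
    unfolding cycle_graph_def by (simp only:) simp
qed

lemma hexagon_rotate_to:
  assumes "is_cycle 6 C" "v \<in> vertices C"
  obtains p q z r s where "distinct [v, p, q, z, r, s]" "C = cycle_graph [v, p, q, z, r, s]"
proof -
  obtain xs where xs: "length xs = 6" "distinct xs" "C = cycle_graph xs"
    using assms(1) by (auto simp: is_cycle_def)
  then obtain a b c d e f where abc: "xs = [a, b, c, d, e, f]"
    by (auto simp: numeral_eq_Suc length_Suc_conv)
  define P where "P = (\<lambda>ys. distinct ys \<and> C = cycle_graph ys)"
  have "P [a, b, c, d, e, f]"
    using xs abc by (simp add: P_def)
  moreover have rot: "P [b, c, d, e, f, a]" if "P [a, b, c, d, e, f]" for a b c d e f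
    using that unfolding P_def cycle_graph_6 by auto
  ultimately have "P [a, b, c, d, e, f]" "P [b, c, d, e, f, a]" "P [c, d, e, f, a, b]"
    "P [d, e, f, a, b, c]" "P [e, f, a, b, c, d]" "P [f, a, b, c, d, e]"
    by blast+
  moreover have "v \<in> {a, b, c, d, e, f}"
    using assms(2) xs(3) by (simp add: abc cycle_graph_6)
  ultimately have "\<exists>p q z r s. P [v, p, q, z, r, s]"
    by blast
  then show ?thesis
    using that by (auto simp only: P_def)
qed

lemma graph_dist_le: "(adjacent G ^^ k) u v \<Longrightarrow> graph_dist G u v \<le> k"
  unfolding graph_dist_def by (rule Least_le)

lemma hexagon_antipode:
  assumes "graph_dist (cycle_graph [v, p, q, z, r, s]) v x = 3" "x \<in> {v, p, q, z, r, s}"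
  shows "x = z"
proof (rule ccontr)
  let ?C = "cycle_graph [v, p, q, z, r, s]"
  assume "x \<noteq> z"
  have adj: "adjacent ?C v p" "adjacent ?C p q" "adjacent ?C s r" "adjacent ?C v s"
    unfolding adjacent_def cycle_graph_6 by (auto simp: insert_commute)
  have "(adjacent ?C ^^ 0) v v" "(adjacent ?C ^^ 1) v p" "(adjacent ?C ^^ 1) v s"
    "(adjacent ?C ^^ 2) v q" "(adjacent ?C ^^ 2) v r"
    using adj by (auto simp: numeral_2_eq_2)
  then have "\<exists>k \<le> 2. (adjacent ?C ^^ k) v x"
    using assms(2) \<open>x \<noteq> z\<close> zero_le[of "2::nat"] one_le_numeral[where 'a = nat]
    by (elim insertE emptyE) blast+
  then show False
    using graph_dist_le assms(1) by fastforce
qed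

lemma hexagon_at:
  assumes "is_cycle 6 C" "z \<in> vertices C"
  obtains v p q r s where "distinct [v, p, q, z, r, s]" "C = cycle_graph [v, p, q, z, r, s]"
proof -
  obtain a b c d e where *: "distinct [z, a, b, c, d, e]" "C = cycle_graph [z, a, b, c, d, e]"
    using hexagon_rotate_to[OF assms] .
  show ?thesis
    by (rule that[of c d e a b]) (use * in \<open>auto simp: cycle_graph_6\<close>)
qed

lemma attach_cycle_graph:
  assumes "w \<in> vertices G"
  shows "attach_hexagon G w p q z r s =
    (vertices G \<union> vertices (cycle_graph [w, p, q, z, r, s]),
     edges G \<union> edges (cycle_graph [w, p, q, z, r, s]))"
  using assms by (auto simp: attach_hexagon_def cycle_graph_6)

lemma para_hexagonal_cactus_chain:
  assumes "para_hexagonal_cactus n G"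
  obtains w where "hexagon_chain n G w"
proof -
  obtain B where n: "n \<ge> 1"
    and cyc: "\<And>i. i \<in> {1..n} \<Longrightarrow> is_cycle 6 (B i)"
    and cut: "\<And>i. i \<in> {1..n-1} \<Longrightarrow> card (vertices (B i) \<inter> vertices (B (i+1))) = 1"
    and disj: "\<And>i j. i \<in> {1..n} \<Longrightarrow> j \<in> {1..n} \<Longrightarrow> i + 1 < j \<Longrightarrow>
      vertices (B i) \<inter> vertices (B j) = {}"
    and dist: "\<And>i u w. i \<in> {2..n-1} \<Longrightarrow> u \<in> vertices (B (i-1)) \<inter> vertices (B i) \<Longrightarrow>
      w \<in> vertices (B i) \<inter> vertices (B (i+1)) \<Longrightarrow> graph_dist (B i) u w = 3"
    and G: "G = (\<Union>i\<in>{1..n}. vertices (B i), \<Union>i\<in>{1..n}. edges (B i))"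
    using assms unfolding para_hexagonal_cactus_def by blast
  define P where "P k = (\<Union>i\<in>{1..k}. vertices (B i), \<Union>i\<in>{1..k}. edges (B i))" for k
  have P_Suc: "P (Suc k) = (vertices (P k) \<union> vertices (B (Suc k)), edges (P k) \<union> edges (B (Suc k)))"
    for k
    by (auto simp: P_def atLeastAtMostSuc_conv)
  have "1 \<le> k \<Longrightarrow> k \<le> n \<Longrightarrow> \<exists>w. hexagon_chain k (P k) w \<and> w \<in> vertices (B k) \<and>
      (k < n \<longrightarrow> w \<in> vertices (B (k+1)))" for k
  proof (induction k)
    case (Suc k)
    have cyc_Suc: "is_cycle 6 (B (Suc k))"
      using cyc Suc.prems by simp
    obtain x where x: "x \<in> vertices (B (Suc k))" "Suc k < n \<Longrightarrow> x \<in> vertices (B (Suc k + 1))"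
    proof (cases "Suc k < n")
      case True
      then have "vertices (B (Suc k)) \<inter> vertices (B (Suc k + 1)) \<noteq> {}"
        using cut[of "Suc k"] by force
      then show ?thesis using that by blast
    next
      case False
      obtain xs where "length xs = 6" "B (Suc k) = cycle_graph xs"
        using cyc_Suc by (auto simp: is_cycle_def)
      then have "xs ! 0 \<in> vertices (B (Suc k))"
        by (simp add: cycle_graph_def)
      then show ?thesis using that False by blast
    qed
    show ?case
    proof (cases "k = 0")
      case True
      obtain v p q r s where hex: "distinct [v, p, q, x, r, s]"
        "B (Suc k) = cycle_graph [v, p, q, x, r, s]"
        using hexagon_at[OF cyc_Suc x(1)] .
      have "hexagon_chain (Suc 0) (attach_hexagon ({v}, {}) v p q x r s) x"
        using hex(1) by (intro hexagon_chain.intros) auto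
      moreover have "P (Suc 0) = attach_hexagon ({v}, {}) v p q x r s"
        using hex(2) True by (auto simp: P_Suc attach_cycle_graph P_def cycle_graph_6)
      ultimately show ?thesis
        using x True by auto
    next
      case False
      then obtain w where w: "hexagon_chain k (P k) w" "w \<in> vertices (B k)"
        "w \<in> vertices (B (Suc k))"
        using Suc by auto
      obtain p q z r s where hex: "distinct [w, p, q, z, r, s]"
        "B (Suc k) = cycle_graph [w, p, q, z, r, s]"
        using hexagon_rotate_to[OF cyc_Suc w(3)] .
      have "vertices (P k) \<inter> vertices (B (Suc k)) \<subseteq> {w}"
      proof
        fix v assume v: "v \<in> vertices (P k) \<inter> vertices (B (Suc k))"
        then obtain i where i: "i \<in> {1..k}" "v \<in> vertices (B i)"
          by (auto simp: P_def)
        have "\<not> i + 1 < Suc k"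
          using disj[of i "Suc k"] i v Suc.prems by auto
        then have "v \<in> vertices (B k) \<inter> vertices (B (k + 1))"
          using i v by (simp add: le_antisym)
        moreover have "k \<in> {1..n-1}"
          using False Suc.prems by auto
        then obtain u where "vertices (B k) \<inter> vertices (B (k + 1)) = {u}"
          using card_1_singletonE[OF cut] by blast
        ultimately show "v \<in> {w}"
          using w by (metis Int_iff Suc_eq_plus1 singletonD singletonI)
      qed
      then have "vertices (P k) \<inter> {p, q, z, r, s} = {}"
        using hex by (auto simp: cycle_graph_6)
      then have "hexagon_chain (Suc k) (attach_hexagon (P k) w p q z r s) z"
        using hex(1) w(1) by (intro hexagon_chain.intros) auto
      moreover have "attach_hexagon (P k) w p q z r s = P (Suc k)"
        using attach_cycle_graph[OF hexagon_chain_wf(2)[OF w(1)]] hex(2) P_Suc by metis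
      moreover have "z \<in> vertices (B (Suc k))"
        using hex(2) by (simp add: cycle_graph_6)
      moreover have "z \<in> vertices (B (Suc k + 1))" if "Suc k < n"
      proof -
        have "graph_dist (B (Suc k)) w x = 3"
          using False that w x by (intro dist) auto
        then have "x = z"
          using hexagon_antipode[of w p q z r s x] x(1) hex(2) by (simp add: cycle_graph_6)
        then show ?thesis using x(2) that by simp
      qed
      ultimately show ?thesis by auto
    qed
  qed simp
  from this[OF n order_refl] show ?thesis
    using that G P_def by metis
qed

theorem theorem2p19:
  fixes G :: "nat \<Rightarrow> 'a sgraph" and g :: "nat \<Rightarrow> nat"
  assumes "\<And>n. n \<ge> 1 \<Longrightarrow> para_hexagonal_cactus n (G n)"
    and "\<And>n. n \<ge> 1 \<Longrightarrow> g n = num_maximal_independent_sets (G n)"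
  shows "g 1 = 5 \<and> g 2 = 19 \<and> g 3 = 76 \<and>
    (\<forall>n\<ge>4. int (g n) = 5 * int (g (n - 1)) - 4 * int (g (n - 2)) + int (g (n - 3)))"
proof -
  have g: "g n = (case state_counts n of (a, b, c) \<Rightarrow> a + b)" if "n \<ge> 1" for n
    using assms that para_hexagonal_cactus_chain num_maximal_independent_sets_chain by metis
  have "int (g n) = 5 * int (g (n - 1)) - 4 * int (g (n - 2)) + int (g (n - 3))" if "n \<ge> 4" for n
  proof -
    define m where "m = n - 3"
    have n: "n = Suc (Suc (Suc m))" "m \<ge> 1"
      using that by (simp_all add: m_def)
    show ?thesis
      using n(2) by (simp add: n(1) g numeral_eq_Suc split: prod.split)
  qed
  then show ?thesis
    by (simp add: g numeral_eq_Suc)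
qed

end
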